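(* Let $R$ be an integral domain and let $J\subseteq I$ be nonzero ideals of $R$. (a) For $x\in R$: if $x\in\widetilde{I}$, then $I$ is a $t$-reduction of $I+Rx$. (b) Assume $I$ is finitely generated. If $I\subseteq \widetilde{J}$, then $J$ is a $t$-reduction of $I$. Moreover, both implications are irreversible in general: there exist an integral domain $R$, a nonzero ideal $I$ of $R$ and $x\in R$ such that $I$ is a $t$-reduction of $I+Rx$ but $x\notin\widetilde{I}$; and there exist an integral domain $R$ and nonzero ideals $J\subseteq I$ of $R$ with $I$ finitely generated such that $J$ is a $t$-reduction of $I$ but $I\not\subseteq\widetilde{J}$.
   Context: All rings are commutative with identity. Let $R$ be an integral domain with quotient field $K$. For a nonzero fractional ideal $I$ of $R$, put $I^{-1}:=\{x\in K\mid xI\subseteq R\}$, $I_v:=(I^{-1})^{-1}$, and $I_t:=\bigcup J_v$, where $J$ ranges over the nonzero finitely generated subideals of $I$. For nonzero ideals $J\subseteq I$ of $R$, $J$ is a $t$-reduction of $I$ if $(JI^{n})_{t}=(I^{n+1})_{t}$ for some integer $n\geq 0$. For a nonzero ideal $I$ of $R$, an element $x\in R$ is $t$-integral over $I$ if there is an equation $x^{n}+a_{1}x^{n-1}+\dots+a_{n-1}x+a_{n}=0$ with $n\geq 1$ and $a_{i}\in (I^{i})_{t}$ for all $i=1,\dots,n$. The $t$-integral closure $\widetilde{I}$ of $I$ is the set of all elements of $R$ that are $t$-integral over $I$. *)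

theory Defs
  imports "HOL-Algebra.Algebra" "HOL-Computational_Algebra.Formal_Laurent_Series"
begin

text \<open>As usual, the domain \<open>R\<close> is regarded as a subring of its quotient field \<open>K\<close>: the record
  \<open>R\<close> is the record \<open>K\<close> with a smaller carrier.\<close>

definition quotient_field_of ::
    "('a, 'm) ring_scheme \<Rightarrow> ('a, 'm) ring_scheme \<Rightarrow> bool" where
  "quotient_field_of K R \<longleftrightarrow>
     field K \<and> subring (carrier R) K \<and> R = K\<lparr>carrier := carrier R\<rparr> \<and>
     (\<forall>x\<in>carrier K. \<exists>a\<in>carrier R. \<exists>b\<in>carrier R - {\<zero>\<^bsub>K\<^esub>}. x = a \<otimes>\<^bsub>K\<^esub> inv\<^bsub>K\<^esub> b)"

definition nonzero_ideal :: "'a set \<Rightarrow> ('a, 'm) ring_scheme \<Rightarrow> bool" where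
  "nonzero_ideal I R \<longleftrightarrow> ideal I R \<and> I \<noteq> {\<zero>\<^bsub>R\<^esub>}"

definition fg_ideal :: "'a set \<Rightarrow> ('a, 'm) ring_scheme \<Rightarrow> bool" where
  "fg_ideal I R \<longleftrightarrow> (\<exists>A \<subseteq> carrier R. finite A \<and> I = Idl\<^bsub>R\<^esub> A)"

abbreviation ideal_power :: "('a, 'm) ring_scheme \<Rightarrow> 'a set \<Rightarrow> nat \<Rightarrow> 'a set" where
  "ideal_power R I n \<equiv> I [^]\<^bsub>ideals_set R\<^esub> n"

definition fractional_inverse ::
    "('a, 'm) ring_scheme \<Rightarrow> ('a, 'm) ring_scheme \<Rightarrow> 'a set \<Rightarrow> 'a set" where
  "fractional_inverse K R I = {x \<in> carrier K. \<forall>a\<in>I. x \<otimes>\<^bsub>K\<^esub> a \<in> carrier R}"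

definition v_closure ::
    "('a, 'm) ring_scheme \<Rightarrow> ('a, 'm) ring_scheme \<Rightarrow> 'a set \<Rightarrow> 'a set" where
  "v_closure K R I = fractional_inverse K R (fractional_inverse K R I)"

text \<open>The \<open>t\<close>-closure is only needed for integral ideals \<open>I \<subseteq> R\<close>; the finitely generated
  subideals of such an \<open>I\<close> are ideals of \<open>R\<close>.\<close>

definition t_closure ::
    "('a, 'm) ring_scheme \<Rightarrow> ('a, 'm) ring_scheme \<Rightarrow> 'a set \<Rightarrow> 'a set" where
  "t_closure K R I = \<Union> {v_closure K R J | J. nonzero_ideal J R \<and> fg_ideal J R \<and> J \<subseteq> I}"

definition t_reduction ::
    "('a, 'm) ring_scheme \<Rightarrow> ('a, 'm) ring_scheme \<Rightarrow> 'a set \<Rightarrow> 'a set \<Rightarrow> bool" where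
  "t_reduction K R J I \<longleftrightarrow>
     nonzero_ideal J R \<and> nonzero_ideal I R \<and> J \<subseteq> I \<and>
     (\<exists>n::nat. t_closure K R (J \<cdot>\<^bsub>R\<^esub> ideal_power R I n) = t_closure K R (ideal_power R I (n + 1)))"

definition t_integral ::
    "('a, 'm) ring_scheme \<Rightarrow> ('a, 'm) ring_scheme \<Rightarrow> 'a set \<Rightarrow> 'a \<Rightarrow> bool" where
  "t_integral K R I x \<longleftrightarrow>
     (\<exists>n::nat. n \<ge> 1 \<and>
       (\<exists>a. (\<forall>i\<in>{1..n}. a i \<in> t_closure K R (ideal_power R I i)) \<and>
            x [^]\<^bsub>R\<^esub> n \<oplus>\<^bsub>R\<^esub> (\<Oplus>\<^bsub>R\<^esub>i\<in>{1..n}. a i \<otimes>\<^bsub>R\<^esub> x [^]\<^bsub>R\<^esub> (n - i)) = \<zero>\<^bsub>R\<^esub>))"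

definition t_integral_closure ::
    "('a, 'm) ring_scheme \<Rightarrow> ('a, 'm) ring_scheme \<Rightarrow> 'a set \<Rightarrow> 'a set" where
  "t_integral_closure K R I = {x \<in> carrier R. t_integral K R I x}"

end

(*
(a) If x is t-integral over I, say of degree n, then B = I + Rx satisfies x^n \<in> (I B^(n-1))_t, and B^n is
generated by x^n together with I B^(n-1). (b) A finitely generated ideal I of elements t-integral over J is reached from J by
adjoining one generator at a time, so (a) and transitivity of t-reductions apply.

Both converses fail for R = Q + M, where M is the maximal ideal of V = Q((s))[[X]], with J = XR and
I = (X, Xs): since {z \<in> R | zs \<in> R} = M, the v-closure of (1, s) is V, so (JI)_v = X^2 V = (I^2)_v, but
Xs is t-integral over the principal ideal XR only if s is integral over R, which it is not, being
transcendental over the residue field Q.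
*)
theory Submission
  imports Defs "HOL-Algebra.Algebraic_Closure_Type"
begin

section \<open>Products and powers of ideals\<close>

lemma (in ring) ideal_prod_subset:
  assumes "ideal C R" and "\<And>i j. i \<in> I \<Longrightarrow> j \<in> J \<Longrightarrow> i \<otimes> j \<in> C"
  shows "I \<cdot> J \<subseteq> C"
proof
  fix s assume "s \<in> I \<cdot> J"
  then show "s \<in> C"
    by (induction rule: ideal_prod.induct)
      (use assms in \<open>auto intro: additive_subgroup.a_closed[OF ideal.axioms(1)]\<close>)
qed

lemma ideal_prod_mono:
  assumes "I \<subseteq> I'" "J \<subseteq> J'"
  shows "I \<cdot>\<^bsub>R\<^esub> J \<subseteq> I' \<cdot>\<^bsub>R\<^esub> J'"
proof
  fix s assume "s \<in> I \<cdot>\<^bsub>R\<^esub> J"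
  then show "s \<in> I' \<cdot>\<^bsub>R\<^esub> J'"
    by (induction rule: ideal_prod.induct) (use assms in \<open>auto intro: ideal_prod.intros\<close>)
qed

text \<open>Ideals under \<open>ideal_prod\<close> form a commutative monoid with unit R. Exposing
  its record lets \<open>ideal_power\<close> inherit the laws of monoid powers, with R as the zeroth
  power.\<close>

lemma ideals_set_simps [simp]:
  "carrier (ideals_set R) = {I. ideal I R}" "monoid.mult (ideals_set R) = ideal_prod R"
  "monoid.one (ideals_set R) = carrier R"
  by (simp_all add: ideals_set_def)

lemma ideal_power_Suc: "ideal_power R I (Suc n) = ideal_power R I n \<cdot>\<^bsub>R\<^esub> I"
  by simp

lemma (in ring) ideal_power_ideal: "ideal I R \<Longrightarrow> ideal (ideal_power R I n) R"
  by (induction n) (auto simp: ideal_power_Suc oneideal ideal_prod_is_ideal)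

lemma (in cring) ideal_prod_lcomm:
  assumes "ideal I R" "ideal J R" "ideal L R"
  shows "I \<cdot> (J \<cdot> L) = J \<cdot> (I \<cdot> L)"
  using assms by (metis ideal_prod_assoc ideal_prod_commute)

lemma (in cring) ideal_power_Suc2:
  "ideal I R \<Longrightarrow> ideal_power R I (Suc n) = I \<cdot> ideal_power R I n"
  by (simp add: ideal_prod_commute ideal_power_ideal)

lemma (in cring) ideal_power_add:
  "ideal I R \<Longrightarrow> ideal_power R I m \<cdot> ideal_power R I n = ideal_power R I (m + n)"
  using monoid.nat_pow_mult[OF comm_monoid.axioms(1)[OF ideals_set_is_comm_monoid], of I m n]
  by simp

lemma (in cring) ideal_power_1 [simp]: "ideal I R \<Longrightarrow> ideal_power R I (Suc 0) = I"
  by (simp add: ideal_prod_one ideal_prod_commute[OF oneideal])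

lemma ideal_power_mono: "I \<subseteq> J \<Longrightarrow> ideal_power R I n \<subseteq> ideal_power R J n"
  by (induction n) (auto simp: ideal_power_Suc dest: ideal_prod_mono)

text \<open>In a domain the product of nonzero elements of the two factors is a nonzero element of
  the product ideal.\<close>

lemma nonzero_ideal_prod:
  assumes "domain R" "nonzero_ideal I R" "nonzero_ideal J R"
  shows "nonzero_ideal (I \<cdot>\<^bsub>R\<^esub> J) R"
proof -
  interpret domain R by fact
  have I: "ideal I R" and J: "ideal J R" using assms by (auto simp: nonzero_ideal_def)
  obtain a where a: "a \<in> I" "a \<noteq> \<zero>\<^bsub>R\<^esub>"
    using assms(2) additive_subgroup.zero_closed[OF ideal.axioms(1)[OF I]]
    by (auto simp: nonzero_ideal_def)
  obtain b where b: "b \<in> J" "b \<noteq> \<zero>\<^bsub>R\<^esub>"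
    using assms(3) additive_subgroup.zero_closed[OF ideal.axioms(1)[OF J]]
    by (auto simp: nonzero_ideal_def)
  have "a \<otimes>\<^bsub>R\<^esub> b \<noteq> \<zero>\<^bsub>R\<^esub>"
    using a b ideal.Icarr[OF I] ideal.Icarr[OF J] by (simp add: integral_iff)
  then show ?thesis
    using ideal_prod.prod[OF a(1) b(1), of R] ideal_prod_is_ideal[OF I J]
    by (auto simp: nonzero_ideal_def)
qed

lemma nonzero_ideal_power:
  assumes "domain R" "nonzero_ideal I R"
  shows "nonzero_ideal (ideal_power R I n) R"
proof (induction n)
  case 0
  interpret domain R by fact
  have "carrier R \<noteq> {\<zero>\<^bsub>R\<^esub>}" using one_closed one_not_zero by blast
  then show ?case by (simp add: nonzero_ideal_def oneideal)
next
  case (Suc n)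
  then show ?case using nonzero_ideal_prod[OF assms(1)] assms(2) by (simp add: ideal_power_Suc)
qed

section \<open>Adjoining one element to an ideal\<close>

lemma (in cring) mem_add_PIdl:
  assumes "ideal I R" "x \<in> carrier R"
  shows "b \<in> I <+>\<^bsub>R\<^esub> PIdl x \<longleftrightarrow> (\<exists>i\<in>I. \<exists>r\<in>carrier R. b = i \<oplus> r \<otimes> x)"
  using assms by (auto simp: set_add_def' cgenideal_def)

lemma (in cring)
  assumes I: "ideal I R" and x: "x \<in> carrier R"
  shows subset_add_PIdl: "I \<subseteq> I <+>\<^bsub>R\<^esub> PIdl x" and mem_add_PIdl_self: "x \<in> I <+>\<^bsub>R\<^esub> PIdl x"
proof -
  interpret I: ideal I R by (rule I)
  have "\<exists>j\<in>I. \<exists>r\<in>carrier R. i = j \<oplus> r \<otimes> x" if "i \<in> I" for i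
    by (rule bexI[OF _ that], rule bexI[OF _ zero_closed]) (use I.Icarr[OF that] x in simp)
  then show "I \<subseteq> I <+>\<^bsub>R\<^esub> PIdl x" using mem_add_PIdl[OF I x] by blast
  have "\<exists>j\<in>I. \<exists>r\<in>carrier R. x = j \<oplus> r \<otimes> x"
    by (rule bexI[OF _ I.zero_closed], rule bexI[OF _ one_closed]) (use x in simp)
  then show "x \<in> I <+>\<^bsub>R\<^esub> PIdl x" using mem_add_PIdl[OF I x] by blast
qed

lemma (in cring) add_PIdl_ideal:
  "\<lbrakk>ideal I R; x \<in> carrier R\<rbrakk> \<Longrightarrow> ideal (I <+>\<^bsub>R\<^esub> PIdl x) R"
  by (simp add: add_ideals cgenideal_ideal)

section \<open>The v-closure and t-closure of a domain inside its quotient field\<close>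

locale quotient_domain = domain R + K: cring K for R :: "('a, 'm) ring_scheme" (structure) and K :: "('a, 'm) ring_scheme" +
  assumes quot: "quotient_field_of K R"
begin

lemma R_eq: "R = K\<lparr>carrier := carrier R\<rparr>"
  using quot by (simp add: quotient_field_of_def)

text \<open>Terms are normalised to the operations of \<open>R\<close>. The laws for elements of
  \<open>K\<close> outside \<open>R\<close> are then collected in that syntax as
  \<open>K_closed\<close>, \<open>K_ac\<close> and \<open>K_distr\<close>.\<close>

lemma K_ops [simp]:
  "monoid.mult K = monoid.mult R" "ring.add K = ring.add R"
  "ring.zero K = ring.zero R" "monoid.one K = monoid.one R"
  by (subst R_eq, simp)+

lemma carrier_K: "a \<in> carrier R \<Longrightarrow> a \<in> carrier K"
  using quot subringE(1)[of "carrier R" K] by (auto simp: quotient_field_of_def)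

lemmas K_closed = K.m_closed[simplified] K.a_closed[simplified]
lemmas K_ac = K.m_assoc[simplified] K.m_comm[simplified] K.m_lcomm[simplified]
lemmas K_distr = K.r_distr[simplified] K.l_distr[simplified]

abbreviation v where "v \<equiv> v_closure K R"
abbreviation t where "t \<equiv> t_closure K R"

lemma mem_fractional_inverse:
  "x \<in> fractional_inverse K R S \<longleftrightarrow> x \<in> carrier K \<and> (\<forall>s\<in>S. x \<otimes> s \<in> carrier R)"
  by (simp add: fractional_inverse_def)

text \<open>\<open>S\<close> may be any set here, so that a finite set of generators can later stand
  for the ideal it generates, as in \<open>v_Idl\<close>.\<close>

lemma mem_v:
  "b \<in> v S \<longleftrightarrow> b \<in> carrier K \<and>
     (\<forall>x\<in>carrier K. (\<forall>s\<in>S. x \<otimes> s \<in> carrier R) \<longrightarrow> b \<otimes> x \<in> carrier R)"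
  by (auto simp: v_closure_def mem_fractional_inverse)

text \<open>The multiplier 1 sends \<open>S\<close> into R, hence sends the closure into R as
  well.\<close>

lemma v_subset_carrier:
  assumes "S \<subseteq> carrier R"
  shows "v S \<subseteq> carrier R"
proof
  fix b assume b: "b \<in> v S"
  then have "b \<otimes> \<one> \<in> carrier R"
    using assms carrier_K by (subst (asm) mem_v) (auto dest!: bspec[of _ _ \<one>])
  moreover have "b \<in> carrier K" using b by (simp add: mem_v)
  ultimately show "b \<in> carrier R" using K.r_one by simp
qed

lemma v_superset: "S \<subseteq> carrier R \<Longrightarrow> S \<subseteq> v S"
  by (auto simp: mem_v subset_iff carrier_K) (metis K_ac(2) carrier_K)

lemma v_mono: "S \<subseteq> T \<Longrightarrow> v S \<subseteq> v T"
  by (auto simp: mem_v subset_iff)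

text \<open>A multiplier of \<open>T\<close> into R also multiplies \<open>v T\<close>, and with it
  \<open>S\<close>, into R. So \<open>v S\<close> is tested against at least the multipliers that
  define \<open>v T\<close>.\<close>

lemma v_least:
  assumes "S \<subseteq> v T"
  shows "v S \<subseteq> v T"
proof
  fix b assume b: "b \<in> v S"
  have "x \<otimes> s \<in> carrier R"
    if "x \<in> carrier K" "\<forall>u\<in>T. x \<otimes> u \<in> carrier R" "s \<in> S" for x s
    using that assms by (metis K_ac(2) mem_v subsetD)
  with b show "b \<in> v T" by (simp add: mem_v)
qed

lemma v_ideal:
  assumes S: "S \<subseteq> carrier R"
  shows "ideal (v S) R"
proof -
  have R: "b \<in> carrier R" if "b \<in> v S" for b using v_subset_carrier[OF S] that by blast
  have l: "r \<otimes> b \<in> v S" if b: "b \<in> v S" and r: "r \<in> carrier R" for b r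
    unfolding mem_v
  proof (intro conjI ballI impI)
    have bK: "b \<in> carrier K" using b by (simp add: mem_v)
    show "r \<otimes> b \<in> carrier K" by (rule K_closed(1)[OF carrier_K[OF r] bK])
    fix x assume x: "x \<in> carrier K" and "\<forall>s\<in>S. x \<otimes> s \<in> carrier R"
    then have "b \<otimes> x \<in> carrier R" using b unfolding mem_v by blast
    then show "r \<otimes> b \<otimes> x \<in> carrier R"
      using K_ac(1)[OF carrier_K[OF r] bK x] m_closed[OF r] by simp
  qed
  have a: "b \<oplus> c \<in> v S" if b: "b \<in> v S" and c: "c \<in> v S" for b c
    unfolding mem_v
  proof (intro conjI ballI impI)
    have bK: "b \<in> carrier K" and cK: "c \<in> carrier K" using b c by (simp_all add: mem_v)
    show "b \<oplus> c \<in> carrier K" by (rule K_closed(2)[OF bK cK])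
    fix x assume x: "x \<in> carrier K" and "\<forall>s\<in>S. x \<otimes> s \<in> carrier R"
    then have "b \<otimes> x \<in> carrier R" "c \<otimes> x \<in> carrier R" using b c unfolding mem_v by blast+
    then show "(b \<oplus> c) \<otimes> x \<in> carrier R"
      using K_distr(2)[OF bK cK x] a_closed by simp
  qed
  have "\<zero> \<in> v S"
    using K.l_null K.zero_closed unfolding mem_v by simp
  moreover have "\<ominus> b \<in> v S" if "b \<in> v S" for b
    using l[OF that, of "\<ominus> \<one>"] R[OF that] by (simp add: l_minus)
  ultimately have "subgroup (v S) (add_monoid R)"
    using R a by (intro add.subgroupI) auto
  then show ?thesis
    using l R by (intro idealI) (auto simp: ring_axioms m_comm)
qed

text \<open>\<open>v S\<close> is an ideal containing \<open>S\<close>, so it contains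
  \<open>Idl S\<close>; then \<open>v_least\<close> and monotonicity give the two
  inclusions.\<close>

lemma v_Idl:
  assumes "S \<subseteq> carrier R"
  shows "v (Idl S) = v S"
  using assms v_least[of "Idl S" S] v_mono[of S "Idl S"]
  by (auto simp: genideal_minimal v_ideal v_superset genideal_self)

text \<open>If x multiplies aS into R, then xa multiplies S into R, so b(xa) lies in R.\<close>

lemma v_mult:
  assumes a: "a \<in> carrier R" and b: "b \<in> v S" and S: "S \<subseteq> carrier R"
  shows "a \<otimes> b \<in> v ((\<otimes>) a ` S)"
proof -
  have bK: "b \<in> carrier K" using b by (simp add: mem_v)
  have "a \<otimes> b \<otimes> x \<in> carrier R"
    if x: "x \<in> carrier K" "\<forall>s\<in>S. x \<otimes> (a \<otimes> s) \<in> carrier R" for x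
  proof -
    have "x \<otimes> a \<otimes> s \<in> carrier R" if s: "s \<in> S" for s
      using x(2) s K_ac(1)[OF x(1) carrier_K[OF a] carrier_K, of s] subsetD[OF S s] by metis
    then have "b \<otimes> (x \<otimes> a) \<in> carrier R"
      using b K_closed(1)[OF x(1) carrier_K[OF a]] unfolding mem_v by blast
    also have "b \<otimes> (x \<otimes> a) = a \<otimes> b \<otimes> x"
      using K_ac(1)[OF carrier_K[OF a] bK x(1)] K_ac(3)[OF bK carrier_K[OF a] x(1)]
        K_ac(2)[OF x(1) carrier_K[OF a]] by simp
    finally show ?thesis .
  qed
  then show ?thesis unfolding mem_v using K_closed(1)[OF carrier_K[OF a] bK] by blast
qed

text \<open>Finite subsets replace the nonzero finitely generated subideals of the definition;
  unlike these, they are easy to combine and to multiply by an element.\<close>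

lemma mem_t:
  assumes B: "nonzero_ideal B R"
  shows "b \<in> t B \<longleftrightarrow> (\<exists>S. finite S \<and> S \<subseteq> B \<and> b \<in> v S)"
proof -
  have iB: "ideal B R" using B by (simp add: nonzero_ideal_def)
  interpret B: ideal B R by (rule iB)
  obtain c where c: "c \<in> B" "c \<noteq> \<zero>"
    using B B.zero_closed by (auto simp: nonzero_ideal_def)
  have "b \<in> t B" if S: "finite S" "S \<subseteq> B" "b \<in> v S" for S
  proof -
    \<comment> \<open>Adjoining the nonzero element \<open>c\<close> of B makes the generated ideal
      nonzero, as the definition of the t-closure requires, and only enlarges the v-closure.\<close>
    let ?S = "insert c S"
    have S': "?S \<subseteq> carrier R" using S c B.Icarr by auto
    have "nonzero_ideal (Idl ?S) R"
      using genideal_ideal[OF S'] genideal_self[OF S'] c by (auto simp: nonzero_ideal_def)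
    moreover have "fg_ideal (Idl ?S) R" unfolding fg_ideal_def using S' S(1) by blast
    moreover have "Idl ?S \<subseteq> B" using S c by (simp add: genideal_minimal iB)
    moreover have "b \<in> v (Idl ?S)" using v_Idl[OF S'] v_mono[of S ?S] S by auto
    ultimately show ?thesis unfolding t_closure_def by blast
  qed
  moreover have "\<exists>S. finite S \<and> S \<subseteq> B \<and> b \<in> v S" if "b \<in> t B"
  proof -
    from that obtain A where A: "A \<subseteq> carrier R" "finite A" "Idl A \<subseteq> B" "b \<in> v (Idl A)"
      by (auto simp: t_closure_def fg_ideal_def)
    then show ?thesis
      using v_Idl[OF A(1)] genideal_self[OF A(1)] by (intro exI[of _ A]) simp
  qed
  ultimately show ?thesis by metis
qed

lemma t_mono: "A \<subseteq> B \<Longrightarrow> t A \<subseteq> t B"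
  by (auto simp: t_closure_def)

text \<open>The union that defines the t-closure is directed: the v-closures of two finite sets both
  lie in the v-closure of their union.\<close>

lemma finite_subset_t:
  assumes B: "nonzero_ideal B R" and "finite F" "F \<subseteq> t B"
  shows "\<exists>S. finite S \<and> S \<subseteq> B \<and> F \<subseteq> v S"
  using assms(2,3)
proof (induction F)
  case empty
  then show ?case by (intro exI[of _ "{}"]) auto
next
  case (insert b F)
  then obtain S where S: "finite S" "S \<subseteq> B" "F \<subseteq> v S" by auto
  obtain T where T: "finite T" "T \<subseteq> B" "b \<in> v T"
    using insert.prems mem_t[OF B] by auto
  show ?case
    using S T v_mono[of S "S \<union> T"] v_mono[of T "S \<union> T"] by (intro exI[of _ "S \<union> T"]) auto
qed

text \<open>By \<open>finite_subset_t\<close> any two elements of \<open>t B\<close> lie in a common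
  \<open>v S\<close>, which is an ideal inside \<open>t B\<close>; closure under the ring operations
  is inherited from there.\<close>

lemma
  assumes B: "nonzero_ideal B R"
  shows t_ideal: "ideal (t B) R" and t_superset: "B \<subseteq> t B"
proof -
  interpret B: ideal B R using B by (simp add: nonzero_ideal_def)
  have v: "ideal (v S) R" "v S \<subseteq> t B" if "finite S" "S \<subseteq> B" for S
    using that v_ideal[of S] B.a_subset by (auto simp: mem_t[OF B])
  have in_v: "\<exists>S. finite S \<and> S \<subseteq> B \<and> b \<in> v S \<and> c \<in> v S" if "b \<in> t B" "c \<in> t B" for b c
    using finite_subset_t[OF B, of "{b, c}"] that by auto
  have R: "b \<in> carrier R" if b: "b \<in> t B" for b
  proof -
    obtain S where S: "finite S" "S \<subseteq> B" "b \<in> v S" using in_v[OF b b] by auto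
    then show ?thesis using ideal.Icarr[OF v(1)[OF S(1,2)]] by simp
  qed
  have a: "b \<oplus> c \<in> t B" if b: "b \<in> t B" and c: "c \<in> t B" for b c
  proof -
    obtain S where S: "finite S" "S \<subseteq> B" "b \<in> v S" "c \<in> v S" using in_v[OF b c] by auto
    interpret S: ideal "v S" R by (rule v(1)[OF S(1,2)])
    show ?thesis using S.a_closed[OF S(3,4)] v(2)[OF S(1,2)] by auto
  qed
  have l: "r \<otimes> b \<in> t B" if b: "b \<in> t B" and r: "r \<in> carrier R" for b r
  proof -
    obtain S where S: "finite S" "S \<subseteq> B" "b \<in> v S" using in_v[OF b b] by auto
    interpret S: ideal "v S" R by (rule v(1)[OF S(1,2)])
    show ?thesis using S.I_l_closed[OF S(3) r] v(2)[OF S(1,2)] by auto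
  qed
  have "\<ominus> b \<in> t B" if "b \<in> t B" for b
    using l[OF that, of "\<ominus> \<one>"] R[OF that] by (simp add: l_minus)
  moreover have "\<zero> \<in> t B"
    using v(2)[of "{}"] additive_subgroup.zero_closed[OF ideal.axioms(1)[OF v(1)[of "{}"]]] by auto
  ultimately have "subgroup (t B) (add_monoid R)"
    using R a by (intro add.subgroupI) auto
  then show "ideal (t B) R"
    using l R by (intro idealI) (auto simp: ring_axioms m_comm)
  show "B \<subseteq> t B"
  proof
    fix b assume b: "b \<in> B"
    then show "b \<in> t B" using v(2)[of "{b}"] v_superset[of "{b}"] B.Icarr by auto
  qed
qed

text \<open>The t-closure is of finite character: an element of \<open>t A\<close> depends on a
  finite F inside \<open>t B\<close>, which lies in one \<open>v S\<close>, and v-closures are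
  idempotent by \<open>v_least\<close>.\<close>

lemma t_least:
  assumes A: "nonzero_ideal A R" and B: "nonzero_ideal B R" and AB: "A \<subseteq> t B"
  shows "t A \<subseteq> t B"
proof
  fix b assume "b \<in> t A"
  then obtain F where F: "finite F" "F \<subseteq> A" "b \<in> v F" by (auto simp: mem_t[OF A])
  then obtain S where "finite S" "S \<subseteq> B" "F \<subseteq> v S"
    using finite_subset_t[OF B, of F] AB by auto
  then show "b \<in> t B" using F v_least[of F S] by (auto simp: mem_t[OF B])
qed

text \<open>Multiplying by \<open>a\<close> turns a finite subset of B that witnesses
  \<open>b \<in> t B\<close> into a finite subset of the product ideal.\<close>

lemma t_mult:
  assumes A: "nonzero_ideal A R" and B: "nonzero_ideal B R" and a: "a \<in> A" and b: "b \<in> t B"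
  shows "a \<otimes> b \<in> t (A \<cdot> B)"
proof -
  have I: "ideal A R" "ideal B R" using A B by (auto simp: nonzero_ideal_def)
  obtain S where S: "finite S" "S \<subseteq> B" "b \<in> v S" using b by (auto simp: mem_t[OF B])
  have "a \<otimes> b \<in> v ((\<otimes>) a ` S)"
    using S a ideal.Icarr[OF I(1)] ideal.Icarr[OF I(2)] by (intro v_mult) auto
  moreover have "(\<otimes>) a ` S \<subseteq> A \<cdot> B" using S a by (auto intro: ideal_prod.prod)
  ultimately show ?thesis
    using S(1) by (subst mem_t[OF nonzero_ideal_prod[OF domain_axioms A B]]) blast
qed

lemma prod_t_subset:
  assumes A: "nonzero_ideal A R" and B: "nonzero_ideal B R"
  shows "A \<cdot> t B \<subseteq> t (A \<cdot> B)"
  by (intro ideal_prod_subset t_ideal t_mult nonzero_ideal_prod[OF domain_axioms] assms)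

section \<open>t-reductions, t-integrality and the two implications\<close>

text \<open>The product J I^n always lies in I^(n+1), so one inclusion of closures is automatic. The
  other can be tested on I^(n+1) itself, by minimality of the t-closure.\<close>

lemma t_reduction_iff:
  "t_reduction K R J I \<longleftrightarrow> nonzero_ideal J R \<and> nonzero_ideal I R \<and> J \<subseteq> I \<and>
     (\<exists>n. ideal_power R I (Suc n) \<subseteq> t (J \<cdot> ideal_power R I n))"
proof (cases "nonzero_ideal J R \<and> nonzero_ideal I R \<and> J \<subseteq> I")
  case True
  then have JI: "nonzero_ideal J R" "nonzero_ideal I R" "J \<subseteq> I" and I: "ideal I R"
    by (auto simp: nonzero_ideal_def)
  note nz = nonzero_ideal_prod[OF domain_axioms] nonzero_ideal_power[OF domain_axioms]
  have "t (J \<cdot> ideal_power R I n) = t (ideal_power R I (n + 1)) \<longleftrightarrow>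
      ideal_power R I (Suc n) \<subseteq> t (J \<cdot> ideal_power R I n)" (is "?l = ?r \<longleftrightarrow> _") for n
  proof -
    have "?l \<subseteq> ?r"
      using ideal_prod_mono[OF JI(3) order_refl, of R "ideal_power R I n"]
      by (intro t_mono) (simp add: ideal_prod_commute[OF _ I] ideal_power_ideal[OF I])
    moreover have "?r \<subseteq> ?l \<longleftrightarrow> ideal_power R I (Suc n) \<subseteq> ?l"
      using t_least[of "ideal_power R I (Suc n)" "J \<cdot> ideal_power R I n"]
        t_superset[of "ideal_power R I (Suc n)"] nz JI by auto
    ultimately show ?thesis by auto
  qed
  then show ?thesis by (simp add: t_reduction_def)
qed (auto simp: t_reduction_def)

text \<open>The exponent of the reduction is m = n - 1, where n is the degree of the integral
  equation; the target is B^n inside T = (I B^m)_t.\<close>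

lemma t_integral_imp_t_reduction:
  assumes I: "nonzero_ideal I R" and x: "x \<in> carrier R" and int: "t_integral K R I x"
  shows "t_reduction K R I (I <+>\<^bsub>R\<^esub> PIdl x)"
proof -
  have iI: "ideal I R" using I by (simp add: nonzero_ideal_def)
  define B where "B = I <+>\<^bsub>R\<^esub> PIdl x"
  have iB: "ideal B R" and IB: "I \<subseteq> B" and xB: "x \<in> B"
    using add_PIdl_ideal subset_add_PIdl mem_add_PIdl_self iI x by (auto simp: B_def)
  then have B: "nonzero_ideal B R"
    using I additive_subgroup.zero_closed[OF ideal.axioms(1)[OF iI]]
    by (auto simp: nonzero_ideal_def)
  note nz = nonzero_ideal_prod[OF domain_axioms] nonzero_ideal_power[OF domain_axioms]
  note ids = ideal_power_ideal[OF iI] ideal_power_ideal[OF iB]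
  have pow: "x [^] k \<in> ideal_power R B k" for k :: nat
    by (induction k) (auto simp: ideal_power_Suc xB intro: ideal_prod.prod)
  from int obtain n a where n: "n \<ge> 1" and a: "\<And>i. i \<in> {1..n} \<Longrightarrow> a i \<in> t (ideal_power R I i)"
    and eq: "x [^] n \<oplus> (\<Oplus>i\<in>{1..n}. a i \<otimes> x [^] (n - i)) = \<zero>"
    unfolding t_integral_def by blast
  obtain m where m: "n = Suc m" using n by (cases n) auto
  define T where "T = t (I \<cdot> ideal_power R B m)"
  have T: "ideal T R" unfolding T_def by (intro t_ideal nz I B)
  interpret T: ideal T R by (rule T)
  \<comment> \<open>Since i \<ge> 1, one factor I can be split off from I^i, and the other i - 1
    factors enlarged to B; together with x^(n-i) in B^(n-i) this lands in I B^m.\<close>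
  have term_T: "a i \<otimes> x [^] (n - i) \<in> T" if i: "i \<in> {1..n}" for i
  proof -
    obtain j where j: "i = Suc j" using i by (cases i) auto
    have "ideal_power R B (n - i) \<cdot> ideal_power R I i
        = I \<cdot> (ideal_power R I j \<cdot> ideal_power R B (n - i))"
      by (simp only: j ideal_power_Suc2[OF iI] ideal_prod_assoc[OF iI ids(1,2)]
          ideal_prod_commute[OF ids(2) ideal_prod_is_ideal[OF iI ids(1)]])
    also have "\<dots> \<subseteq> I \<cdot> (ideal_power R B j \<cdot> ideal_power R B (n - i))"
      by (intro ideal_prod_mono ideal_power_mono IB order_refl)
    also have "\<dots> = I \<cdot> ideal_power R B m"
      using i by (simp add: ideal_power_add iB j m)
    finally have "t (ideal_power R B (n - i) \<cdot> ideal_power R I i) \<subseteq> T"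
      unfolding T_def by (rule t_mono)
    moreover have "x [^] (n - i) \<otimes> a i \<in> t (ideal_power R B (n - i) \<cdot> ideal_power R I i)"
      by (intro t_mult nz I B pow a i)
    ultimately have "x [^] (n - i) \<otimes> a i \<in> T" by (rule subsetD)
    moreover have "a i \<in> carrier R"
      using ideal.Icarr[OF t_ideal a[OF i]] nz I by blast
    ultimately show ?thesis using x by (simp add: m_comm)
  qed
  have sum_T: "(\<Oplus>i\<in>F. a i \<otimes> x [^] (n - i)) \<in> T" if "F \<subseteq> {1..n}" for F
    using finite_subset[OF that finite_atLeastAtMost] that
  proof (induction F)
    case (insert i F)
    then show ?case
      using term_T T.Icarr by (subst finsum_insert) (auto intro!: T.a_closed)
  qed auto
  have xn: "x [^] n \<in> T"
  proof -
    have s: "(\<Oplus>i\<in>{1..n}. a i \<otimes> x [^] (n - i)) \<in> T" by (rule sum_T) simp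
    have "x [^] n = \<ominus> (\<Oplus>i\<in>{1..n}. a i \<otimes> x [^] (n - i))"
      using eq s T.Icarr x by (intro sum_zero_eq_neg) auto
    then show ?thesis using s T.a_inv_closed by simp
  qed
  \<comment> \<open>For j = 0 and k = n this says that B^n lies in T. The induction on k starts from
    x^n in T; each step splits one factor from B as i + r x with i in I.\<close>
  have claim: "x [^] j \<otimes> c \<in> T" if "j + k = n" "c \<in> ideal_power R B k" for j k c
    using that
  proof (induction k arbitrary: j c)
    case 0
    then show ?case using xn T.I_r_closed by simp
  next
    case (Suc k)
    note jk = Suc.prems(1)
    have iBk: "ideal (ideal_power R B k) R" by (rule ideal_power_ideal[OF iB])
    from Suc.prems(2) show ?case unfolding ideal_power_Suc2[OF iB]
    proof (induction rule: ideal_prod.induct)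
      case (prod b c)
      obtain i r where b: "i \<in> I" "r \<in> carrier R" "b = i \<oplus> r \<otimes> x"
        using prod(1) mem_add_PIdl[OF iI x] by (auto simp: B_def)
      have carr: "i \<in> carrier R" "c \<in> carrier R"
        using ideal.Icarr[OF iI b(1)] ideal.Icarr[OF iBk prod(2)] by simp_all
      \<comment> \<open>The part from I: here j + k = m, so the product lies in I B^m.\<close>
      have "i \<otimes> (x [^] j \<otimes> c) \<in> I \<cdot> (ideal_power R B j \<cdot> ideal_power R B k)"
        by (intro ideal_prod.prod b pow prod)
      also have "\<dots> = I \<cdot> ideal_power R B m"
        using jk m by (simp add: ideal_power_add iB)
      finally have 1: "i \<otimes> (x [^] j \<otimes> c) \<in> T"
        using t_superset[OF nz(1)[OF I nz(2)[OF B]]] unfolding T_def by blast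
      \<comment> \<open>The part from Rx: its x joins the power of x, and the induction hypothesis
        applies with j + 1.\<close>
      have 2: "r \<otimes> (x [^] Suc j \<otimes> c) \<in> T"
        using T.I_l_closed[OF Suc.IH[of "Suc j" c] b(2)] jk prod(2) by simp
      have "x [^] j \<otimes> (b \<otimes> c) = i \<otimes> (x [^] j \<otimes> c) \<oplus> r \<otimes> (x [^] Suc j \<otimes> c)"
        using b carr x by (simp add: r_distr l_distr m_ac)
      then show ?case using T.a_closed[OF 1 2] by simp
    next
      case (sum c d)
      then show ?case
        using ideal.Icarr[OF ideal_prod_is_ideal[OF iB iBk]] x T.a_closed[OF sum(3,4)]
        by (simp add: r_distr)
    qed
  qed
  have "ideal_power R B (Suc m) \<subseteq> T"
    using claim[of 0 n] ideal.Icarr[OF ideal_power_ideal[OF iB, of n]] by (auto simp: m)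
  then show ?thesis
    using I B IB by (auto simp: t_reduction_iff T_def B_def[symmetric])
qed

text \<open>If n and m are exponents for J in L and for L in I, then m + n is one for J in
  I.\<close>

lemma t_reduction_trans:
  assumes JL: "t_reduction K R J L" and LI: "t_reduction K R L I"
  shows "t_reduction K R J I"
proof -
  note nz = nonzero_ideal_prod[OF domain_axioms] nonzero_ideal_power[OF domain_axioms]
  obtain n m where J: "nonzero_ideal J R" and L: "nonzero_ideal L R" and I: "nonzero_ideal I R"
    and sub: "J \<subseteq> L" "L \<subseteq> I"
    and n: "ideal_power R L (Suc n) \<subseteq> t (J \<cdot> ideal_power R L n)"
    and m: "ideal_power R I (Suc m) \<subseteq> t (L \<cdot> ideal_power R I m)"
    using assms by (auto simp: t_reduction_iff)
  have iI: "ideal I R" and iL: "ideal L R" and iJ: "ideal J R"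
    using I J L by (auto simp: nonzero_ideal_def)
  let ?I = "ideal_power R I" and ?L = "ideal_power R L"
  note ids = ideal_power_ideal[OF iI] ideal_power_ideal[OF iL] iI iL iJ
  \<comment> \<open>One factor I is traded for L at a time, at the cost of keeping I^m in reserve;
    inner closures are absorbed by \<open>prod_t_subset\<close> and \<open>t_least\<close>.\<close>
  have step: "?I (m + k) \<subseteq> t (?L k \<cdot> ?I m)" for k
  proof (induction k)
    case 0
    have "carrier R \<cdot> ?I m = ?I m"
      using ideal_prod_one[OF ids(1)] ideal_prod_commute[OF oneideal ids(1)] by metis
    then show ?case using t_superset[OF nz(2)[OF I]] by simp
  next
    case (Suc k)
    have "?I (m + Suc k) = ?I k \<cdot> ?I (Suc m)"
      using ideal_power_add[OF iI, of k "Suc m"] by (simp add: add.commute)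
    also have "\<dots> \<subseteq> ?I k \<cdot> t (L \<cdot> ?I m)" by (intro ideal_prod_mono m order_refl)
    also have "\<dots> \<subseteq> t (?I k \<cdot> (L \<cdot> ?I m))" by (intro prod_t_subset nz I L)
    also have "?I k \<cdot> (L \<cdot> ?I m) = L \<cdot> ?I (m + k)"
      by (simp only: ideal_prod_lcomm[OF ids(1,4,1)] ideal_power_add[OF iI] add.commute[of k])
    also have "t (L \<cdot> ?I (m + k)) \<subseteq> t (L \<cdot> (?L k \<cdot> ?I m))"
    proof (rule t_least)
      have "L \<cdot> ?I (m + k) \<subseteq> L \<cdot> t (?L k \<cdot> ?I m)" by (intro ideal_prod_mono Suc order_refl)
      also have "\<dots> \<subseteq> t (L \<cdot> (?L k \<cdot> ?I m))" by (intro prod_t_subset nz I L)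
      finally show "L \<cdot> ?I (m + k) \<subseteq> t (L \<cdot> (?L k \<cdot> ?I m))" .
    qed (intro nz I L)+
    also have "L \<cdot> (?L k \<cdot> ?I m) = ?L (Suc k) \<cdot> ?I m"
      using ids by (simp only: ideal_power_Suc2[OF iL] ideal_prod_assoc)
    finally show ?case .
  qed
  \<comment> \<open>For k = n + 1 the factor L^(n+1) can be traded for J L^n under the closure; then
    L^n is enlarged to I^n.\<close>
  have "?I (Suc (m + n)) \<subseteq> t (?L (Suc n) \<cdot> ?I m)" using step[of "Suc n"] by simp
  also have "\<dots> \<subseteq> t (J \<cdot> ?I (m + n))"
  proof (rule t_least)
    have "?L (Suc n) \<cdot> ?I m \<subseteq> t (J \<cdot> ?L n) \<cdot> ?I m" by (intro ideal_prod_mono n order_refl)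
    also have "\<dots> = ?I m \<cdot> t (J \<cdot> ?L n)"
      by (intro ideal_prod_commute t_ideal nz J L ids)
    also have "\<dots> \<subseteq> t (?I m \<cdot> (J \<cdot> ?L n))" by (intro prod_t_subset nz I J L)
    also have "\<dots> \<subseteq> t (?I m \<cdot> (J \<cdot> ?I n))"
      by (intro t_mono ideal_prod_mono ideal_power_mono sub order_refl)
    also have "?I m \<cdot> (J \<cdot> ?I n) = J \<cdot> ?I (m + n)"
      by (simp only: ideal_prod_lcomm[OF ids(1,5,1)] ideal_power_add[OF iI])
    finally show "?L (Suc n) \<cdot> ?I m \<subseteq> t (J \<cdot> ?I (m + n))" .
  qed (intro nz I L J)+
  finally show ?thesis using J I sub by (auto simp: t_reduction_iff)
qed

text \<open>Generators are t-integral over \<open>J\<close>, but each one is adjoined to an ideal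
  that may already be larger than \<open>J\<close>.\<close>

lemma t_integral_mono:
  assumes "J \<subseteq> I" "t_integral K R J x"
  shows "t_integral K R I x"
  using assms(2) t_mono[OF ideal_power_mono[OF assms(1)]] unfolding t_integral_def by blast

text \<open>Exponent 0 works, since J^1 = J R.\<close>

lemma t_reduction_refl: "nonzero_ideal J R \<Longrightarrow> t_reduction K R J J"
  using t_superset[of J] ideal_prod_one[of J] ideal_power_1[of J]
  by (auto simp: t_reduction_iff nonzero_ideal_def simp del: nat_pow_Suc intro!: exI[of _ 0])

lemma t_integral_imp_t_reduction_fg:
  assumes J: "nonzero_ideal J R" and JI: "J \<subseteq> I" and I: "fg_ideal I R"
    and int: "I \<subseteq> t_integral_closure K R J"
  shows "t_reduction K R J I"
proof -
  obtain A where A: "A \<subseteq> carrier R" "finite A" "I = Idl A" using I by (auto simp: fg_ideal_def)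
  \<comment> \<open>L is the ideal reached after adjoining the generators in F to J. The bound by I
    is kept so that L = I once F is the whole generating set.\<close>
  have "\<exists>L. ideal L R \<and> F \<union> J \<subseteq> L \<and> L \<subseteq> I \<and> t_reduction K R J L" if "F \<subseteq> A" for F
    using finite_subset[OF that A(2)] that
  proof (induction F)
    case empty
    then show ?case using J JI t_reduction_refl by (auto simp: nonzero_ideal_def)
  next
    case (insert x F)
    then obtain L where L: "ideal L R" "F \<union> J \<subseteq> L" "L \<subseteq> I" "t_reduction K R J L" by auto
    have x: "x \<in> I" "x \<in> carrier R" using insert.prems A genideal_self by auto
    have "t_integral K R L x"
      using t_integral_mono[of J L] L int x by (auto simp: t_integral_closure_def)
    then have red: "t_reduction K R L (L <+>\<^bsub>R\<^esub> PIdl x)"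
      using L x by (intro t_integral_imp_t_reduction) (auto simp: t_reduction_def)
    have "L <+>\<^bsub>R\<^esub> PIdl x \<subseteq> I"
    proof
      interpret I: ideal I R using A genideal_ideal by simp
      fix b assume "b \<in> L <+>\<^bsub>R\<^esub> PIdl x"
      then obtain i r where "i \<in> L" "r \<in> carrier R" "b = i \<oplus> r \<otimes> x"
        using mem_add_PIdl[OF L(1) x(2)] by auto
      then show "b \<in> I" using I.a_closed[of i] I.I_l_closed[OF x(1)] L(3) by auto
    qed
    moreover have "insert x F \<union> J \<subseteq> L <+>\<^bsub>R\<^esub> PIdl x"
      using L(2) subset_add_PIdl[OF L(1) x(2)] mem_add_PIdl_self[OF L(1) x(2)] by auto
    ultimately show ?case
      using add_PIdl_ideal[OF L(1) x(2)] t_reduction_trans[OF L(4) red]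
      by (intro exI[of _ "L <+>\<^bsub>R\<^esub> PIdl x"]) simp
  qed
  from this[of A] obtain L where L: "ideal L R" "A \<subseteq> L" "L \<subseteq> I" "t_reduction K R J L" by auto
  then have "L = I" using A genideal_minimal[OF L(1,2)] by simp
  then show ?thesis using L by simp
qed

end

section \<open>The counterexample ring and its quotient field\<close>

text \<open>\<open>K0\<close> is \<open>\<rat>((s))((X))\<close>, with \<open>s\<close> the inner variable (\<open>S0\<close> below), and \<open>R0\<close> is
  \<open>\<rat> + X \<rat>((s))[[X]]\<close>.\<close>

definition K0 :: "rat fls fls ring" where "K0 = ring_of_type_algebra"

definition R0 :: "rat fls fls ring" where
  "R0 = K0\<lparr>carrier := fps_to_fls ` {p. p $ 0 \<in> range fls_const}\<rparr>"

lemma K0_simps [simp]: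
  "carrier K0 = UNIV" "monoid.mult K0 = (*)" "ring.add K0 = (+)"
  "ring.zero K0 = 0" "monoid.one K0 = 1"
  by (simp_all add: K0_def ring_of_type_algebra_def fun_eq_iff)

lemma R0_simps [simp]:
  "monoid.mult R0 = (*)" "ring.add R0 = (+)" "ring.zero R0 = 0" "monoid.one R0 = 1"
  by (simp_all add: R0_def)

lemma carrier_R0: "f \<in> carrier R0 \<longleftrightarrow> (\<exists>p. f = fps_to_fls p \<and> p $ 0 \<in> range fls_const)"
  by (auto simp: R0_def)

lemma field_K0: "field K0"
  unfolding K0_def by (rule field_from_type_algebra)

text \<open>Taking the constant coefficient in X is a ring homomorphism on power series, and the
  constants form a subring of \<rat>((s)).\<close>

lemma subring_R0: "subring (carrier R0) K0"
proof -
  interpret field K0 by (rule field_K0)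
  have K0_uminus: "\<ominus>\<^bsub>K0\<^esub> f = - f" for f
    by (rule minus_equality) auto
  show ?thesis
  proof (rule subringI)
    fix f g assume "f \<in> carrier R0" "g \<in> carrier R0"
    then obtain p q c d where fg: "f = fps_to_fls p" "g = fps_to_fls q"
      and c: "p $ 0 = fls_const c" "q $ 0 = fls_const d"
      by (auto simp: carrier_R0)
    have "f * g = fps_to_fls (p * q)" "(p * q) $ 0 = fls_const (c * d)"
      "f + g = fps_to_fls (p + q)" "(p + q) $ 0 = fls_const (c + d)"
      by (simp_all add: fg c fls_times_fps_to_fls fls_plus_const)
    then show "f \<otimes>\<^bsub>K0\<^esub> g \<in> carrier R0" "f \<oplus>\<^bsub>K0\<^esub> g \<in> carrier R0"
      unfolding carrier_R0 K0_simps by blast+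
  next
    fix f assume "f \<in> carrier R0"
    then obtain p c where "f = fps_to_fls p" "p $ 0 = fls_const c" by (auto simp: carrier_R0)
    then have "- f = fps_to_fls (- p)" "(- p) $ 0 = fls_const (- c)" by simp_all
    then show "\<ominus>\<^bsub>K0\<^esub> f \<in> carrier R0" unfolding carrier_R0 K0_uminus by blast
  next
    have "1 = fps_to_fls (1 :: rat fls fps)" "(1 :: rat fls fps) $ 0 = fls_const 1" by simp_all
    then show "\<one>\<^bsub>K0\<^esub> \<in> carrier R0" unfolding carrier_R0 K0_simps by blast
  qed simp
qed

text \<open>The series without constant term form the maximal ideal M of V, which lies in R whatever
  their coefficients in \<rat>((s)) are.\<close>

lemma fps_to_fls_in_R0: "p $ 0 = 0 \<Longrightarrow> fps_to_fls p \<in> carrier R0"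
  unfolding carrier_R0 by (intro exI[of _ p] conjI refl) (metis fls_const_0 rangeI)

lemma fls_X_in_R0: "fls_X \<in> carrier R0"
  using fps_to_fls_in_R0[of fps_X] by simp

lemma quotient_field_of_R0: "quotient_field_of K0 R0"
  unfolding quotient_field_of_def
proof (intro conjI ballI)
  interpret field K0 by (rule field_K0)
  fix f assume "f \<in> carrier K0"
  \<comment> \<open>One more than the pole order of f in X, or 1 if there is no pole. Thus both f
    X^n and X^n have zero constant term, lie in M, and exhibit f as a quotient.\<close>
  define n where "n = Suc (nat (- fls_subdegree f))"
  have n: "- int n < fls_subdegree f" "n > 0" by (auto simp: n_def)
  have sub: "fls_subdegree (f * fls_X ^ n) \<ge> 0"
    using n by (cases "f = 0") (auto simp: fls_subdegree_mult_fls_X_power)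
  have "f * fls_X ^ n = fps_to_fls (fls_regpart (f * fls_X ^ n))"
    using sub by simp
  moreover have "fls_regpart (f * fls_X ^ n) $ 0 = 0"
    using n by (simp add: fls_X_power_times_conv_shift)
  ultimately have 1: "f * fls_X ^ n \<in> carrier R0"
    using fps_to_fls_in_R0 by metis
  have 2: "(fls_X ^ n :: rat fls fls) \<in> carrier R0"
    using fps_to_fls_in_R0[of "fps_X ^ n"] n by (simp add: fps_to_fls_power)
  have 3: "inv\<^bsub>K0\<^esub> (fls_X ^ n) = inverse (fls_X ^ n)"
    by (rule comm_inv_char) auto
  show "\<exists>a\<in>carrier R0. \<exists>b\<in>carrier R0 - {\<zero>\<^bsub>K0\<^esub>}. f = a \<otimes>\<^bsub>K0\<^esub> inv\<^bsub>K0\<^esub> b"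
    by (rule bexI[OF _ 1], rule bexI[of _ "fls_X ^ n"]) (use 2 in \<open>auto simp: 3\<close>)
qed (rule field_K0, rule subring_R0, simp add: R0_def)

lemma domain_R0: "domain R0"
proof -
  interpret field K0 by (rule field_K0)
  show ?thesis using subring_is_domain[OF subring_R0] by (simp add: R0_def)
qed

interpretation R0: quotient_domain R0 K0
  by (intro quotient_domain.intro quotient_domain_axioms.intro
      domain_R0 fieldE(1)[OF field_K0] quotient_field_of_R0)

lemma R0_pow [simp]: "f [^]\<^bsub>R0\<^esub> (n :: nat) = f ^ n"
  by (induction n) (auto simp: mult.commute)

lemma R0_finsum:
  assumes "finite F" "\<And>i. i \<in> F \<Longrightarrow> f i \<in> carrier R0"
  shows "(\<Oplus>\<^bsub>R0\<^esub>i\<in>F. f i) = (\<Sum>i\<in>F. f i)"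
  using assms
proof (induction F)
  case (insert i F)
  then show ?case by (subst R0.finsum_insert) auto
qed simp

abbreviation S0 :: "rat fls fls" where "S0 \<equiv> fls_const fls_X"

text \<open>If z has constant coefficient c in \<rat> and c s is again rational, then c = 0. So z
  lies in M, and M absorbs every power of s. In effect s^2 lies in the v-closure of (1, s).\<close>

lemma mult_S0_sq_in_R0:
  assumes "z \<in> carrier R0" "z * S0 \<in> carrier R0"
  shows "z * S0 ^ 2 \<in> carrier R0"
proof -
  obtain p c where p: "z = fps_to_fls p" "p $ 0 = fls_const c" using assms(1) by (auto simp: carrier_R0)
  obtain q d where q: "z * S0 = fps_to_fls q" "q $ 0 = fls_const d" using assms(2) by (auto simp: carrier_R0)
  have "fps_to_fls (p * fps_const fls_X) = fps_to_fls q"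
    using p q by (simp add: fls_times_fps_to_fls)
  then have "q = p * fps_const fls_X" by simp
  then have "fls_const c * fls_X = fls_const d" using p q by simp
  then have "fls_nth (fls_const c * fls_X) 1 = fls_nth (fls_const d) 1" by simp
  then have "c = 0" by simp
  moreover have "z * S0 ^ 2 = fps_to_fls (p * fps_const (fls_X ^ 2))"
    by (simp add: p fls_times_fps_to_fls fls_const_power)
  ultimately show ?thesis using fps_to_fls_in_R0 p by simp
qed

section \<open>The ideals XR and (X, Xs), and the t-reduction between them\<close>

abbreviation J0 where "J0 \<equiv> PIdl\<^bsub>R0\<^esub> (fls_X :: rat fls fls)"
abbreviation I0 where "I0 \<equiv> J0 <+>\<^bsub>R0\<^esub> PIdl\<^bsub>R0\<^esub> (fls_X * S0)"

lemma XS_in_R0: "fls_X * S0 \<in> carrier R0"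
  using fps_to_fls_in_R0[of "fps_X * fps_const fls_X"] by (simp add: fls_times_fps_to_fls)

lemma fls_X_in_J0: "fls_X \<in> J0"
  by (rule R0.cgenideal_self[OF fls_X_in_R0])

lemma ideal_J0: "ideal J0 R0"
  by (rule R0.cgenideal_ideal[OF fls_X_in_R0])

lemma J0_subset_I0: "J0 \<subseteq> I0" and XS_in_I0: "fls_X * S0 \<in> I0"
  by (rule R0.subset_add_PIdl[OF ideal_J0 XS_in_R0], rule R0.mem_add_PIdl_self[OF ideal_J0 XS_in_R0])

lemma ideal_I0: "ideal I0 R0"
  by (rule R0.add_PIdl_ideal[OF ideal_J0 XS_in_R0])

lemma nonzero_J0: "nonzero_ideal J0 R0" and nonzero_I0: "nonzero_ideal I0 R0"
proof -
  have "fls_X \<noteq> (0 :: rat fls fls)" by simp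
  then have "J0 \<noteq> {0}" "I0 \<noteq> {0}" using fls_X_in_J0 J0_subset_I0 by blast+
  then show "nonzero_ideal J0 R0" "nonzero_ideal I0 R0"
    using ideal_J0 ideal_I0 by (simp_all add: nonzero_ideal_def)
qed

lemma fg_I0: "fg_ideal I0 R0"
proof -
  have "I0 = Idl\<^bsub>R0\<^esub> {fls_X, fls_X * S0}"
  proof
    show "Idl\<^bsub>R0\<^esub> {fls_X, fls_X * S0} \<subseteq> I0"
      using subsetD[OF J0_subset_I0 fls_X_in_J0] XS_in_I0
      by (intro R0.genideal_minimal ideal_I0) simp
    have A: "{fls_X, fls_X * S0} \<subseteq> carrier R0" using fls_X_in_R0 XS_in_R0 by simp
    interpret A: ideal "Idl\<^bsub>R0\<^esub> {fls_X, fls_X * S0}" R0 by (rule R0.genideal_ideal[OF A])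
    have "J0 \<subseteq> Idl\<^bsub>R0\<^esub> {fls_X, fls_X * S0}" "PIdl\<^bsub>R0\<^esub> (fls_X * S0) \<subseteq> Idl\<^bsub>R0\<^esub> {fls_X, fls_X * S0}"
      using R0.genideal_self[OF A] by (intro R0.cgenideal_minimal A.ideal_axioms; simp)+
    then show "I0 \<subseteq> Idl\<^bsub>R0\<^esub> {fls_X, fls_X * S0}"
      using A.a_closed by (auto simp: set_add_def')
  qed
  then show ?thesis unfolding fg_ideal_def
    using fls_X_in_R0 XS_in_R0 by (intro exI[of _ "{fls_X, fls_X * S0}"] conjI) simp_all
qed

lemma t_reduction_J0_I0: "t_reduction K0 R0 J0 I0"
proof -
  have nz: "nonzero_ideal (J0 \<cdot>\<^bsub>R0\<^esub> I0) R0"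
    by (rule nonzero_ideal_prod[OF domain_R0 nonzero_J0 nonzero_I0])
  let ?T = "t_closure K0 R0 (J0 \<cdot>\<^bsub>R0\<^esub> I0)"
  have T: "ideal ?T R0" by (rule R0.t_ideal[OF nz])
  interpret T: ideal ?T R0 by (rule T)
  have JI: "j * i \<in> ?T" if "j \<in> J0" "i \<in> I0" for i j
    using R0.t_superset[OF nz] ideal_prod.prod[OF that, of R0] by auto
  \<comment> \<open>The square of Xs is the one product of generators of \<open>I0\<close> without a
    factor X from \<open>J0\<close>; all others are in the product ideal already.\<close>
  have xx: "(fls_X * S0) * (fls_X * S0) \<in> ?T"
  proof -
    let ?A = "{fls_X * fls_X, fls_X * (fls_X * S0)}"
    have "?A \<subseteq> J0 \<cdot>\<^bsub>R0\<^esub> I0"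
      using ideal_prod.prod[OF fls_X_in_J0 subsetD[OF J0_subset_I0 fls_X_in_J0], of R0]
        ideal_prod.prod[OF fls_X_in_J0 XS_in_I0, of R0] by simp
    moreover have "(fls_X * S0) * (fls_X * S0) \<in> v_closure K0 R0 ?A"
      unfolding R0.mem_v
    proof (intro conjI ballI impI)
      fix y assume "\<forall>s\<in>?A. y \<otimes>\<^bsub>R0\<^esub> s \<in> carrier R0"
      \<comment> \<open>\<open>mult_S0_sq_in_R0\<close> is applied to z = y X^2: the two elements of
        \<open>?A\<close> say that z and z s lie in R.\<close>
      then have "y * (fls_X * fls_X) * S0 ^ 2 \<in> carrier R0"
        by (intro mult_S0_sq_in_R0) (auto simp: mult_ac)
      then show "fls_X * S0 * (fls_X * S0) \<otimes>\<^bsub>R0\<^esub> y \<in> carrier R0"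
        by (simp add: mult_ac power2_eq_square)
    qed simp
    ultimately show ?thesis
      unfolding R0.mem_t[OF nz] by (intro exI[of _ ?A]) simp
  qed
  have "I0 \<cdot>\<^bsub>R0\<^esub> I0 \<subseteq> ?T"
  proof (rule R0.ideal_prod_subset[OF T])
    fix i j assume i: "i \<in> I0" and j: "j \<in> I0"
    obtain a p where a: "a \<in> J0" "p \<in> carrier R0" "i = a + p * (fls_X * S0)"
      using i R0.mem_add_PIdl[OF ideal_J0 XS_in_R0] by auto
    obtain b q where b: "b \<in> J0" "q \<in> carrier R0" "j = b + q * (fls_X * S0)"
      using j R0.mem_add_PIdl[OF ideal_J0 XS_in_R0] by auto
    have "a * j \<in> ?T" by (rule JI[OF a(1) j])
    moreover have "p * (b * (fls_X * S0)) \<in> ?T"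
      using T.I_l_closed[OF JI[OF b(1) XS_in_I0] a(2)] by simp
    moreover have "p * (q * ((fls_X * S0) * (fls_X * S0))) \<in> ?T"
      using T.I_l_closed[OF T.I_l_closed[OF xx b(2)] a(2)] by simp
    moreover have "i * j = a * j + (p * (b * (fls_X * S0)) + p * (q * ((fls_X * S0) * (fls_X * S0))))"
      by (simp add: a(3) b(3) algebra_simps)
    ultimately show "i \<otimes>\<^bsub>R0\<^esub> j \<in> ?T" using T.a_closed by simp
  qed
  \<comment> \<open>The reduction holds with exponent n = 1.\<close>
  then have "ideal_power R0 I0 (Suc 1) \<subseteq> t_closure K0 R0 (J0 \<cdot>\<^bsub>R0\<^esub> ideal_power R0 I0 1)"
    using R0.ideal_power_1[OF ideal_I0] R0.ideal_power_Suc2[OF ideal_I0, of "Suc 0"] by (simp only: One_nat_def)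
  then show ?thesis
    unfolding R0.t_reduction_iff using nonzero_J0 nonzero_I0 J0_subset_I0 by blast
qed

section \<open>Failure of t-integrality for Xs over XR\<close>

lemma J0_power: "ideal_power R0 J0 i \<subseteq> PIdl\<^bsub>R0\<^esub> (fls_X ^ i)"
proof (induction i)
  case 0
  show ?case by (auto simp: cgenideal_def)
next
  case (Suc i)
  have X: "(fls_X :: rat fls fls) ^ k \<in> carrier R0" for k
    using R0.nat_pow_closed[OF fls_X_in_R0, of k] by simp
  show ?case unfolding ideal_power_Suc
  proof (rule R0.ideal_prod_subset[OF R0.cgenideal_ideal[OF X]])
    fix a b assume "a \<in> ideal_power R0 J0 i" "b \<in> J0"
    then obtain r s where "a = r * fls_X ^ i" "r \<in> carrier R0" "b = s * fls_X" "s \<in> carrier R0"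
      using Suc by (auto simp: cgenideal_def)
    then have "a * b = (r * s) * fls_X ^ Suc i" "r * s \<in> carrier R0"
      using R0.m_closed[of r s] by (simp_all add: mult_ac)
    then show "a \<otimes>\<^bsub>R0\<^esub> b \<in> PIdl\<^bsub>R0\<^esub> (fls_X ^ Suc i)" by (auto simp: cgenideal_def)
  qed
qed

text \<open>Principal ideals are t-closed: X^(-i) multiplies X^i R into R, hence also the v-closure
  of each of its subsets.\<close>

lemma t_J0_power:
  assumes "a \<in> t_closure K0 R0 (ideal_power R0 J0 i)"
  shows "\<exists>r\<in>carrier R0. a = r * fls_X ^ i"
proof -
  let ?y = "inverse (fls_X ^ i)"
  obtain A where A: "A \<subseteq> ideal_power R0 J0 i" "a \<in> v_closure K0 R0 A"
    using assms R0.mem_t[OF nonzero_ideal_power[OF domain_R0 nonzero_J0]] by blast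
  have "?y * s \<in> carrier R0" if "s \<in> A" for s
  proof -
    have "s \<in> PIdl\<^bsub>R0\<^esub> (fls_X ^ i)" using that A(1) J0_power[of i] by (meson subsetD)
    then obtain r where "s = r * fls_X ^ i" "r \<in> carrier R0" by (auto simp: cgenideal_def)
    then show ?thesis by (simp add: mult.left_commute)
  qed
  then have "a * ?y \<in> carrier R0" using A(2) unfolding R0.mem_v by simp
  then show ?thesis by (intro bexI[of _ "a * ?y"]) auto
qed

text \<open>The coefficients of an integral equation are p_i X^i with p_i in R. Cancelling X^n
  leaves a monic equation for s over R, and setting X = 0 one over \<rat>.\<close>

lemma not_t_integral: "\<not> t_integral K0 R0 J0 (fls_X * S0)"
proof
  let ?x = "fls_X * S0"
  assume "t_integral K0 R0 J0 ?x"
  then obtain n a where n: "n \<ge> 1"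
    and a: "\<And>i. i \<in> {1..n} \<Longrightarrow> a i \<in> t_closure K0 R0 (ideal_power R0 J0 i)"
    and eq: "?x [^]\<^bsub>R0\<^esub> n \<oplus>\<^bsub>R0\<^esub> (\<Oplus>\<^bsub>R0\<^esub>i\<in>{1..n}. a i \<otimes>\<^bsub>R0\<^esub> ?x [^]\<^bsub>R0\<^esub> (n - i)) = \<zero>\<^bsub>R0\<^esub>"
    unfolding t_integral_def by blast
  have "\<exists>p c. a i = fps_to_fls p * fls_X ^ i \<and> p $ 0 = fls_const c" if i: "i \<in> {1..n}" for i
  proof -
    obtain r where r: "r \<in> carrier R0" "a i = r * fls_X ^ i" using t_J0_power[OF a[OF i]] by blast
    obtain p c where "r = fps_to_fls p" "p $ 0 = fls_const c"
      using r(1) unfolding carrier_R0 by (elim exE conjE imageE) simp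
    then show ?thesis using r(2) by (intro exI[of _ p] exI[of _ c]) simp
  qed
  then obtain p c where p: "\<And>i. i \<in> {1..n} \<Longrightarrow> a i = fps_to_fls (p i) * fls_X ^ i"
    and c: "\<And>i. i \<in> {1..n} \<Longrightarrow> p i $ 0 = fls_const (c i)"
    by metis
  have aR: "a i \<in> carrier R0" if "i \<in> {1..n}" for i
    using ideal.Icarr[OF R0.t_ideal[OF nonzero_ideal_power[OF domain_R0 nonzero_J0]] a[OF that]] .
  have xR: "?x ^ k \<in> carrier R0" for k
    using R0.nat_pow_closed[OF XS_in_R0, of k] by simp
  have "a i * ?x ^ (n - i) \<in> carrier R0" if "i \<in> {1..n}" for i
    using R0.m_closed[OF aR[OF that] xR] by simp
  then have "(\<Oplus>\<^bsub>R0\<^esub>i\<in>{1..n}. a i * ?x ^ (n - i)) = (\<Sum>i\<in>{1..n}. a i * ?x ^ (n - i))"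
    by (intro R0_finsum) auto
  with eq have "?x ^ n + (\<Sum>i\<in>{1..n}. a i * ?x ^ (n - i)) = 0" by simp
  \<comment> \<open>The equation is homogeneous in X: X^i from a_i and X^(n-i) from the power of Xs
    combine to X^n.\<close>
  moreover have "a i * ?x ^ (n - i) = fls_X ^ n * fps_to_fls (p i * fps_const fls_X ^ (n - i))"
    if "i \<in> {1..n}" for i
    using that by (simp add: p power_mult_distrib fls_times_fps_to_fls fls_const_power
        flip: power_add mult.assoc)
  ultimately have "fls_X ^ n * (fps_to_fls (fps_const fls_X ^ n) +
      (\<Sum>i\<in>{1..n}. fps_to_fls (p i * fps_const fls_X ^ (n - i)))) = 0"
    by (simp add: sum_distrib_left distrib_left power_mult_distrib fls_const_power)
  then have "fps_to_fls (fps_const fls_X ^ n) +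
      (\<Sum>i\<in>{1..n}. fps_to_fls (p i * fps_const fls_X ^ (n - i))) = 0"
    by simp
  \<comment> \<open>The inner \<open>fls_nth\<close> takes the coefficient of X^0, the outer one
    that of s^n.\<close>
  then have "fls_nth (fls_nth (fps_to_fls (fps_const fls_X ^ n) +
      (\<Sum>i\<in>{1..n}. fps_to_fls (p i * fps_const fls_X ^ (n - i)))) 0) (int n) = 0"
    by simp
  \<comment> \<open>At X = 0 the i-th term is c_i s^(n-i) with c_i rational and i \<ge> 1, so it
    contributes nothing to s^n, while the leading term contributes 1.\<close>
  moreover have "fls_nth (fls_nth (\<Sum>i\<in>{1..n}. fps_to_fls (p i * fps_const fls_X ^ (n - i))) 0) (int n) = 0"
    using c by (auto simp: fls_nth_sum intro!: sum.neutral)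
  ultimately show False by (simp flip: fls_const_power)
qed

theorem proposition3p7:
  shows
    "(\<forall>(R :: ('a, 'm) ring_scheme) K I J.
        domain R \<and> quotient_field_of K R \<and> nonzero_ideal I R \<and> nonzero_ideal J R \<and> J \<subseteq> I \<longrightarrow>
          (\<forall>x\<in>carrier R. x \<in> t_integral_closure K R I \<longrightarrow>
             t_reduction K R I (I <+>\<^bsub>R\<^esub> PIdl\<^bsub>R\<^esub> x)) \<and>
          (fg_ideal I R \<longrightarrow> I \<subseteq> t_integral_closure K R J \<longrightarrow> t_reduction K R J I)) \<and>
     (\<exists>(R :: rat fls fls ring) K I x.
        domain R \<and> quotient_field_of K R \<and> nonzero_ideal I R \<and> x \<in> carrier R \<and>
        t_reduction K R I (I <+>\<^bsub>R\<^esub> PIdl\<^bsub>R\<^esub> x) \<and>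
        x \<notin> t_integral_closure K R I) \<and>
     (\<exists>(R :: rat fls fls ring) K I J.
        domain R \<and> quotient_field_of K R \<and> nonzero_ideal I R \<and> nonzero_ideal J R \<and> J \<subseteq> I \<and>
        fg_ideal I R \<and>
        t_reduction K R J I \<and>
        \<not> I \<subseteq> t_integral_closure K R J)"
proof (intro conjI allI impI)
  fix R K :: "('a, 'm) ring_scheme" and I J
  assume A: "domain R \<and> quotient_field_of K R \<and> nonzero_ideal I R \<and> nonzero_ideal J R \<and> J \<subseteq> I"
  then interpret quotient_domain R K
    by (intro quotient_domain.intro quotient_domain_axioms.intro fieldE(1))
      (auto simp: quotient_field_of_def)
  show "\<forall>x\<in>carrier R. x \<in> t_integral_closure K R I \<longrightarrow>
      t_reduction K R I (I <+>\<^bsub>R\<^esub> PIdl\<^bsub>R\<^esub> x)"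
    using A t_integral_imp_t_reduction by (simp add: t_integral_closure_def)
  show "t_reduction K R J I" if "fg_ideal I R" "I \<subseteq> t_integral_closure K R J"
    using A that t_integral_imp_t_reduction_fg by simp
next
  show "\<exists>(R :: rat fls fls ring) K I x.
      domain R \<and> quotient_field_of K R \<and> nonzero_ideal I R \<and> x \<in> carrier R \<and>
      t_reduction K R I (I <+>\<^bsub>R\<^esub> PIdl\<^bsub>R\<^esub> x) \<and> x \<notin> t_integral_closure K R I"
    \<comment> \<open>\<open>I0\<close> is by definition J0 + R Xs, so the same reduction serves
      both counterexamples.\<close>
    by (rule exI[of _ R0], rule exI[of _ K0], rule exI[of _ J0], rule exI[of _ "fls_X * S0"])
      (intro conjI domain_R0 quotient_field_of_R0 nonzero_J0 XS_in_R0 t_reduction_J0_I0,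
        simp add: t_integral_closure_def not_t_integral)
next
  have "\<not> I0 \<subseteq> t_integral_closure K0 R0 J0"
    using XS_in_I0 not_t_integral unfolding t_integral_closure_def by blast
  then show "\<exists>(R :: rat fls fls ring) K I J.
      domain R \<and> quotient_field_of K R \<and> nonzero_ideal I R \<and> nonzero_ideal J R \<and> J \<subseteq> I \<and>
      fg_ideal I R \<and> t_reduction K R J I \<and> \<not> I \<subseteq> t_integral_closure K R J"
    by (intro exI[of _ R0] exI[of _ K0] exI[of _ I0] exI[of _ J0] conjI domain_R0
        quotient_field_of_R0 nonzero_I0 nonzero_J0 J0_subset_I0 fg_I0 t_reduction_J0_I0)
qed

end
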